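(* Let $a$ be a real number with $1<a<10$, let $L=L^{\langle a\rangle}$ be as in the context, and let $\omega$ be the unique real number $\omega>1$ with $L(\omega)=\omega$. For a real starting value $x>1$ consider the trajectory $x, L(x), L(L(x)), L(L(L(x))),\dots$. Then one of the following holds: (i) $x=\omega$ and the trajectory is $\omega,\omega,\omega,\dots$; (ii) the trajectory converges to $\omega$; (iii) $x$ lies in a two-term cycle (i.e. $L(L(x))=x$ and $L(x)\ne x$) and the trajectory simply repeats that cycle; (iv) the trajectory converges to a two-term limit cycle, i.e. there are $p\neq q$, both $>1$, with $L(p)=q$, $L(q)=p$, such that the even-indexed terms of the trajectory converge to one of $p,q$ and the odd-indexed terms to the other; (v) the trajectory diverges, alternately approaching $1$ and $\infty$ (one of the even-indexed and odd-indexed subsequences tends to $1$ and the other to $\infty$).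
   Context: Every real $a$ with $1<a<10$ has a decimal expansion $a=\sum_{i=0}^{\infty} c_i 10^{-i}$ with $c_i\in\{0,1,\dots,9\}$ and $c_0\ne 0$, where expansions ending in infinitely many $9$'s are excluded. Define, for real $x>1$, $L^{\langle a\rangle}(x):=\sum_{i=0}^{\infty} c_i x^{-i}$ (the value of "$a$ interpreted in base $x$"); this converges for $x>1$ and is strictly decreasing in $x$ when $a$ is not an integer, and constant equal to $a$ when $a$ is an integer. The equation $L^{\langle a\rangle}(x)=x$ has a unique solution $x=\omega$ in the range $x>1$. *)

theory Defs
  imports "HOL-Analysis.Analysis"
begin

definition decimal_expansion :: "real \<Rightarrow> (nat \<Rightarrow> nat) \<Rightarrow> bool" where
  "decimal_expansion a c \<longleftrightarrow>
     (\<forall>i. c i \<in> {0..9}) \<and> c 0 \<noteq> 0 \<and>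
     (\<lambda>i. real (c i) / 10 ^ i) sums a \<and>
     \<not> (\<exists>N. \<forall>i\<ge>N. c i = 9)"

definition decimal_digits :: "real \<Rightarrow> nat \<Rightarrow> nat" where
  "decimal_digits a = (THE c. decimal_expansion a c)"

definition L :: "real \<Rightarrow> real \<Rightarrow> real" where
  "L a x = (\<Sum>i. real (decimal_digits a i) / x ^ i)"

definition trajectory :: "real \<Rightarrow> real \<Rightarrow> nat \<Rightarrow> real" where
  "trajectory a x n = (L a ^^ n) x"

text \<open>The remaining facts show that the descriptions above are well defined: the expansion
  exists and is unique for \<open>1 < a < 10\<close>, the series converges for \<open>x > 1\<close>, \<open>L a\<close> maps
  \<open>x > 1\<close> to values \<open>> 1\<close>, and it has exactly one fixed point there.\<close>

lemma digits_summable: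
  assumes "\<forall>i. c i \<in> {0..9::nat}" "(x::real) > 1"
  shows "summable (\<lambda>i. real (c i) / x ^ i)"
proof (rule summable_comparison_test')
  show "summable (\<lambda>i. 9 * (1 / x) ^ i)"
    using assms by (intro summable_mult summable_geometric) auto
  fix n
  have "real (c n) \<le> 9" using assms(1) by (simp add: atLeastAtMost_iff)
  then show "norm (real (c n) / x ^ n) \<le> 9 * (1 / x) ^ n"
    using assms(2) by (simp add: power_divide divide_right_mono)
qed

lemma digits_head_tail:
  assumes dig: "\<forall>i. c i \<in> {0..9::nat}" and s: "(\<lambda>i. real (c i) / 10 ^ i) sums a"
    and n9: "\<not> (\<exists>N. \<forall>i\<ge>N. c i = 9)"
  shows "int (c 0) = \<lfloor>a\<rfloor>"
    and "(\<lambda>i. real (c (Suc i)) / 10 ^ i) sums (10 * (a - real (c 0)))"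
    and "\<not> (\<exists>N. \<forall>i\<ge>N. c (Suc i) = 9)"
proof -
  have t: "(\<lambda>i. real (c (Suc i)) / 10 ^ Suc i) sums (a - real (c 0))"
    using s sums_Suc_iff[of "\<lambda>i. real (c i) / 10 ^ i" "a - real (c 0)"] by simp
  from sums_mult[OF this, of 10]
  show "(\<lambda>i. real (c (Suc i)) / 10 ^ i) sums (10 * (a - real (c 0)))" by simp
  show n9': "\<not> (\<exists>N. \<forall>i\<ge>N. c (Suc i) = 9)"
  proof
    assume "\<exists>N. \<forall>i\<ge>N. c (Suc i) = 9"
    then obtain N where N: "\<And>i. i \<ge> N \<Longrightarrow> c (Suc i) = 9" by blast
    have "c i = 9" if "i \<ge> Suc N" for i
      using N[of "i - 1"] that by simp
    then show False using n9 by blast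
  qed
  have g: "(\<lambda>i. 9 / 10 ^ Suc i :: real) sums 1"
    using sums_mult[OF geometric_sums[of "1/10::real"], of "9/10"]
    by (simp add: power_divide)
  have le: "real (c (Suc i)) \<le> 9" for i
    using dig by (simp add: atLeastAtMost_iff)
  obtain k where k: "c (Suc k) \<noteq> 9" using n9' by blast
  have d: "(\<lambda>i. (9 - real (c (Suc i))) / 10 ^ Suc i) sums (1 - (a - real (c 0)))"
    using sums_diff[OF g t] by (simp add: diff_divide_distrib)
  have "0 < (\<Sum>i. (9 - real (c (Suc i))) / 10 ^ Suc i)"
  proof (rule suminf_pos2[where i = k])
    show "summable (\<lambda>i. (9 - real (c (Suc i))) / 10 ^ Suc i)"
      using d by (rule sums_summable)
    show "0 \<le> (9 - real (c (Suc i))) / 10 ^ Suc i" for i using le[of i] by simp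
    have "real (c (Suc k)) \<noteq> 9" using k by linarith
    with le[of k] show "0 < (9 - real (c (Suc k))) / 10 ^ Suc k" by simp
  qed
  with d have "a - real (c 0) < 1" by (simp add: sums_iff)
  moreover have "0 \<le> a - real (c 0)"
    using t by (intro sums_le[OF _ sums_zero t]) simp
  ultimately show "int (c 0) = \<lfloor>a\<rfloor>" by linarith
qed

lemma digits_unique:
  assumes "\<forall>i. c i \<in> {0..9::nat}" "(\<lambda>i. real (c i) / 10 ^ i) sums a"
    "\<not> (\<exists>N. \<forall>i\<ge>N. c i = 9)"
    "\<forall>i. d i \<in> {0..9::nat}" "(\<lambda>i. real (d i) / 10 ^ i) sums a"
    "\<not> (\<exists>N. \<forall>i\<ge>N. d i = 9)"
  shows "c n = d n"
  using assms
proof (induction n arbitrary: c d a)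
  case 0
  then show ?case using digits_head_tail(1)[of c a] digits_head_tail(1)[of d a] by simp
next
  case (Suc n)
  note C = digits_head_tail[OF Suc.prems(1-3)] and D = digits_head_tail[OF Suc.prems(4-6)]
  have e: "c 0 = d 0" using C(1) D(1) by simp
  show ?case
    using Suc.IH[of "\<lambda>i. c (Suc i)" "10 * (a - real (c 0))" "\<lambda>i. d (Suc i)"]
      C(2,3) D(2,3) Suc.prems(1,4) e by simp
qed

lemma decimal_expansion_ex1:
  assumes "1 < a" "a < 10"
  shows "\<exists>!c. decimal_expansion a c"
proof (rule ex_ex1I)
  define f where "f i = \<lfloor>a * 10 ^ i\<rfloor>" for i :: nat
  define c where "c i = nat (f i mod 10)" for i
  have rc: "real (c i) = of_int (f i mod 10)" for i by (simp add: c_def)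
  have f0: "1 \<le> f 0" "f 0 < 10" using assms by (auto simp: f_def floor_less_iff le_floor_iff)
  have step: "f (Suc i) = 10 * f i + f (Suc i) mod 10" for i
  proof -
    have "f i = \<lfloor>(a * 10 ^ Suc i) / real_of_int 10\<rfloor>" by (simp add: f_def)
    also have "\<dots> = f (Suc i) div 10"
      using floor_divide_real_eq_div[of 10 "a * 10 ^ Suc i"] by (simp add: f_def)
    finally show ?thesis by simp
  qed
  have part: "(\<Sum>i<Suc n. real (c i) / 10 ^ i) = of_int (f n) / 10 ^ n" for n
  proof (induction n)
    case 0
    then show ?case using f0 by (simp add: rc)
  next
    case (Suc n)
    have "real_of_int (f (Suc n)) = 10 * of_int (f n) + of_int (f (Suc n) mod 10)"
      by (subst step) simp
    then show ?case using Suc by (simp add: rc field_simps)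
  qed
  have bd: "a - 1 / 10 ^ n < of_int (f n) / 10 ^ n" "of_int (f n) / 10 ^ n \<le> a" for n
  proof -
    have "a * 10 ^ n - 1 < of_int (f n)" "of_int (f n) \<le> a * 10 ^ n"
      unfolding f_def by linarith+
    moreover have "a - 1 / 10 ^ n = (a * 10 ^ n - 1) / 10 ^ n" by (simp add: diff_divide_distrib)
    ultimately show "a - 1 / 10 ^ n < of_int (f n) / 10 ^ n" "of_int (f n) / 10 ^ n \<le> a"
      by (simp_all only: divide_strict_right_mono pos_divide_le_eq zero_less_power zero_less_numeral)
  qed
  have lim: "(\<lambda>n. (1/10::real) ^ n) \<longlonglongrightarrow> 0" by (rule LIMSEQ_power_zero) simp
  have "(\<lambda>n. \<Sum>i<Suc n. real (c i) / 10 ^ i) \<longlonglongrightarrow> a"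
  proof (rule tendsto_sandwich)
    show "(\<lambda>n. a - (1/10) ^ n) \<longlonglongrightarrow> a" using tendsto_diff[OF tendsto_const lim, of a] by simp
    show "(\<lambda>n. a) \<longlonglongrightarrow> a" by simp
    show "\<forall>\<^sub>F n in sequentially. a - (1/10) ^ n \<le> (\<Sum>i<Suc n. real (c i) / 10 ^ i)"
      using bd(1) by (intro always_eventually allI) (simp only: part, simp add: power_divide less_imp_le)
    show "\<forall>\<^sub>F n in sequentially. (\<Sum>i<Suc n. real (c i) / 10 ^ i) \<le> a"
      using bd(2) by (intro always_eventually allI) (simp only: part)
  qed
  then have sums: "(\<lambda>i. real (c i) / 10 ^ i) sums a"
    unfolding sums_def by (rule LIMSEQ_imp_Suc)
  have n9: "\<not> (\<exists>N. \<forall>i\<ge>N. c i = 9)"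
  proof
    assume "\<exists>N. \<forall>i\<ge>N. c i = 9"
    then obtain N where N: "\<And>i. i \<ge> N \<Longrightarrow> c i = 9" by blast
    have e: "a - of_int (f (N + k)) / 10 ^ (N + k) = (a - of_int (f N) / 10 ^ N) - (1 / 10 ^ N - 1 / 10 ^ (N + k))" for k
    proof (induction k)
      case (Suc k)
      have "f (Suc (N + k)) mod 10 = 9" using N[of "Suc (N + k)"] by (simp add: c_def)
      with step[of "N + k"] have "f (Suc (N + k)) = 10 * f (N + k) + 9" by simp
      then show ?case using Suc by (simp add: field_simps)
    qed simp
    define r where "r = 1 / 10 ^ N - (a - of_int (f N) / 10 ^ N)"
    have "r > 0" using bd(1)[of N] by (simp add: r_def)
    then obtain k where k: "(1/10) ^ k < r" using real_arch_pow_inv[of r "1/10"] by auto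
    have "(1/10::real) ^ (N + k) \<le> (1/10) ^ k" by (rule power_decreasing) auto
    with k e[of k] bd(2)[of "N + k"] show False by (simp add: r_def power_divide)
  qed
  have "decimal_expansion a c"
    unfolding decimal_expansion_def
  proof (intro conjI allI sums n9)
    show "c i \<in> {0..9}" for i
      using pos_mod_bound[of 10 "f i"] by (simp add: c_def)
    show "c 0 \<noteq> 0" using f0 by (simp add: c_def)
  qed
  then show "\<exists>c. decimal_expansion a c" by blast
next
  fix c d assume "decimal_expansion a c" "decimal_expansion a d"
  then show "c = d"
    unfolding decimal_expansion_def using digits_unique by (intro ext) blast
qed

lemma decimal_digits:
  assumes "1 < a" "a < 10"
  shows "decimal_expansion a (decimal_digits a)"
  unfolding decimal_digits_def using decimal_expansion_ex1[OF assms] by (rule theI')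

lemma L_summable:
  assumes "1 < a" "a < 10" "1 < x"
  shows "summable (\<lambda>i. real (decimal_digits a i) / x ^ i)"
  using decimal_digits[OF assms(1,2)] assms(3)
  by (intro digits_summable) (auto simp: decimal_expansion_def)

lemma L_antimono:
  assumes "1 < a" "a < 10" "1 < x" "x \<le> y"
  shows "L a y \<le> L a x"
  unfolding L_def using assms
  by (intro suminf_le L_summable divide_left_mono power_mono) auto

lemma L_ge:
  assumes "1 < a" "a < 10"
  obtains "\<And>x. 1 < x \<Longrightarrow> 2 \<le> L a x" | k where "\<And>x. 1 < x \<Longrightarrow> 1 + 1 / x ^ k \<le> L a x"
proof -
  let ?c = "decimal_digits a"
  have c: "?c 0 \<noteq> 0" "(\<lambda>i. real (?c i) / 10 ^ i) sums a"
    using decimal_digits[OF assms] by (auto simp: decimal_expansion_def)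
  show thesis
  proof (cases "?c 0 \<ge> 2")
    case True
    have "2 \<le> L a x" if "1 < x" for x
    proof -
      have "(\<Sum>i\<in>{0}. real (?c i) / x ^ i) \<le> L a x"
        unfolding L_def using that by (intro sum_le_suminf L_summable assms) auto
      then show ?thesis using True by simp
    qed
    then show thesis by (rule that(1))
  next
    case False
    then have c0: "?c 0 = 1" using c(1) by simp
    have "\<exists>k. k \<noteq> 0 \<and> ?c k \<noteq> 0"
    proof (rule ccontr)
      assume "\<not> ?thesis"
      then have "(\<lambda>i. real (?c i) / 10 ^ i) sums (\<Sum>i\<in>{0}. real (?c i) / 10 ^ i)"
        by (intro sums_finite) (simp, metis divide_eq_0_iff of_nat_0 singletonI)
      with c(2) have "a = 1" using sums_unique2 c0 by fastforce
      then show False using assms by simp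
    qed
    then obtain k where k: "k \<noteq> 0" "?c k \<noteq> 0" by blast
    have "1 + 1 / x ^ k \<le> L a x" if "1 < x" for x
    proof -
      have "(\<Sum>i\<in>{0,k}. real (?c i) / x ^ i) \<le> L a x"
        unfolding L_def using that by (intro sum_le_suminf L_summable assms) auto
      moreover have "1 / x ^ k \<le> real (?c k) / x ^ k"
        using k that by (intro divide_right_mono) auto
      ultimately show ?thesis using k c0 by simp
    qed
    then show thesis by (rule that(2))
  qed
qed

lemma L_gt_1:
  assumes "1 < a" "a < 10" "1 < x"
  shows "1 < L a x"
proof (rule L_ge[OF assms(1,2)])
  assume "\<And>x. 1 < x \<Longrightarrow> 2 \<le> L a x"
  from this[OF assms(3)] show ?thesis by simp
next
  fix k assume "\<And>x. 1 < x \<Longrightarrow> 1 + 1 / x ^ k \<le> L a x"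
  from this[OF assms(3)] show ?thesis
    using assms(3) zero_less_divide_1_iff[of "x ^ k"] zero_less_power[of x k] by linarith
qed

lemma L_isCont:
  assumes "1 < a" "a < 10" "1 < x"
  shows "isCont (L a) x"
proof -
  define r where "r = (1 + x) / 2"
  have r: "1 < r" "r < x" using assms(3) by (auto simp: r_def)
  let ?P = "\<lambda>y. \<Sum>i. real (decimal_digits a i) * y ^ i"
  have "isCont ?P (1 / x)"
  proof (rule isCont_powser)
    show "summable (\<lambda>i. real (decimal_digits a i) * (1 / r) ^ i)"
      using L_summable[OF assms(1,2) r(1)] by (simp add: power_divide)
    show "norm (1 / x) < norm (1 / r)" using r by (simp add: frac_less2)
  qed
  moreover have "isCont (\<lambda>x. 1 / x) x" using assms(3) by (intro continuous_intros) auto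
  ultimately have "isCont (\<lambda>x. ?P (1 / x)) x" by (rule isCont_o2[rotated])
  then show ?thesis by (simp add: L_def[abs_def] power_divide)
qed

lemma fixed_point_ex1:
  assumes "1 < a" "a < 10"
  shows "\<exists>!w. 1 < w \<and> L a w = w"
proof (rule ex_ex1I)
  obtain u where u: "1 < u" "u < 2" "u \<le> L a u"
  proof (rule L_ge[OF assms])
    assume "\<And>x. 1 < x \<Longrightarrow> 2 \<le> L a x"
    from this[of "3/2"] show thesis by (intro that[of "3/2"]) auto
  next
    fix k assume k: "\<And>x. 1 < x \<Longrightarrow> 1 + 1 / x ^ k \<le> L a x"
    have "((\<lambda>x::real. 1 + 1 / x ^ k - x) \<longlongrightarrow> 1 + 1 / 1 ^ k - 1) (at_right 1)"
      by (intro tendsto_intros) auto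
    then have "\<forall>\<^sub>F x in at_right (1::real). 0 < 1 + 1 / x ^ k - x"
      by (rule order_tendstoD) simp
    moreover have "\<forall>\<^sub>F x in at_right (1::real). x \<in> {1<..<2}"
      by (rule eventually_at_right_real) simp
    ultimately have "\<forall>\<^sub>F x in at_right (1::real). 0 < 1 + 1 / x ^ k - x \<and> x \<in> {1<..<2}"
      by (rule eventually_conj)
    then obtain x :: real where "0 < 1 + 1 / x ^ k - x" "x \<in> {1<..<2}"
      using eventually_happens' trivial_limit_at_right_real by blast
    with k[of x] show thesis by (intro that[of x]) auto
  qed
  define v where "v = max 2 (L a 2)"
  have v: "2 \<le> v" "L a v \<le> v" using L_antimono[OF assms, of 2 v] by (auto simp: v_def)
  have "\<exists>w\<ge>u. w \<le> v \<and> w - L a w = 0"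
  proof (rule IVT)
    show "\<forall>w. u \<le> w \<and> w \<le> v \<longrightarrow> isCont (\<lambda>w. w - L a w) w"
      using u L_isCont[OF assms] by (auto intro!: continuous_intros)
  qed (use u v in auto)
  then obtain w where "u \<le> w" "w - L a w = 0" by blast
  then show "\<exists>w. 1 < w \<and> L a w = w" using u by (intro exI[of _ w]) auto
next
  fix w z assume "1 < w \<and> L a w = w" "1 < z \<and> L a z = z"
  then show "w = z"
    using L_antimono[OF assms, of w z] L_antimono[OF assms, of z w] by linarith
qed

end

theory Submission imports Defs "HOL-Probability.Characteristic_Functions" begin

text \<open>Since \<open>L a\<close> is antitone, its square is monotone, so the even-indexed terms form a monotone
  sequence and so do the odd-indexed ones, in the opposite direction. If either sequence has a limit
  \<open>p > 1\<close>, continuity makes the other converge to \<open>L a p\<close> and gives \<open>L a (L a p) = p\<close>, that is,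
  a fixed point or a 2-cycle. Otherwise each of the two tends to \<open>1\<close> or to \<open>\<infinity>\<close>, and
  the opposite directions exclude that both do the same.\<close>

text \<open>The split is on boundedness. The bound by \<open>l\<close> is kept because it later
  places the limit strictly above 1.\<close>

lemma incseq_LIMSEQ_or_at_top:
  fixes s :: "nat \<Rightarrow> real"
  assumes "incseq s"
  obtains l where "s \<longlonglongrightarrow> l" "\<And>n. s n \<le> l" | "filterlim s at_top sequentially"
proof (cases "\<exists>B. \<forall>n. s n \<le> B")
  case True
  then show thesis using assms that(1) incseq_convergent by metis
next
  case False
  have "filterlim s at_top sequentially"
    unfolding filterlim_at_top
  proof
    fix Z
    from False obtain N where "Z < s N" using not_le by blast
    then have "Z \<le> s n" if "n \<ge> N" for n
      using incseqD[OF assms that] by linarith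
    then show "\<forall>\<^sub>F n in sequentially. Z \<le> s n"
      by (auto simp: eventually_sequentially)
  qed
  then show thesis by (rule that(2))
qed

text \<open>The comparison of the first two terms decides the direction, and applying the monotone
  \<open>f\<close> passes it on from each pair of neighbours to the next.\<close>

lemma monotone_recurrence_monoseq:
  fixes s :: "nat \<Rightarrow> 'a::linorder"
  assumes "\<And>n. s (Suc n) = f (s n)" "\<And>n. s n \<in> A" "mono_on A f"
  shows "incseq s \<or> decseq s"
proof (cases "s 0 \<le> s 1")
  case True
  have "s n \<le> s (Suc n)" for n
  proof (induction n)
    case (Suc n)
    then show ?case using assms(1)[of n] assms(1)[of "Suc n"] assms(2) monotone_onD[OF assms(3)] by metis
  qed (use True in simp)
  then show ?thesis by (simp add: incseq_Suc_iff)
next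
  case False
  have "s (Suc n) \<le> s n" for n
  proof (induction n)
    case (Suc n)
    then show ?case using assms(1)[of n] assms(1)[of "Suc n"] assms(2) monotone_onD[OF assms(3)] by metis
  qed (use False in simp)
  then show ?thesis by (simp add: decseq_Suc_iff)
qed

lemma trajectory_Suc: "trajectory a x (Suc n) = L a (trajectory a x n)"
  by (simp add: trajectory_def)

lemma trajectory_gt_1:
  assumes "1 < a" "a < 10" "1 < x"
  shows "1 < trajectory a x n"
  by (induction n) (use assms L_gt_1 in \<open>simp_all add: trajectory_def\<close>)

lemma trajectory_shift_monoseq:
  assumes "1 < a" "a < 10" "1 < x"
  shows "incseq (\<lambda>n. trajectory a x (2 * n + k)) \<or> decseq (\<lambda>n. trajectory a x (2 * n + k))"
proof (rule monotone_recurrence_monoseq)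
  show "trajectory a x (2 * Suc n + k) = (L a \<circ> L a) (trajectory a x (2 * n + k))" for n
    by (simp add: trajectory_Suc)
  show "trajectory a x (2 * n + k) \<in> {1<..}" for n
    using trajectory_gt_1[OF assms] by simp
  show "mono_on {1<..} (L a \<circ> L a)"
    by (intro mono_onI) (simp add: L_antimono L_gt_1 assms)
qed

text \<open>An increasing sequence has its limit at or above \<open>s 0\<close>, hence above 1, so
  the limit 1 comes only from a decreasing sequence and the limit \<infinity> only from an
  increasing one. The inequalities with \<open>s 0\<close> record that direction for the comparison
  of even and odd terms; \<open>k\<close> is 0 or 1 there.\<close>

lemma trajectory_shift_cases:
  fixes k :: nat
  assumes "1 < a" "a < 10" "1 < x"
  defines "s \<equiv> \<lambda>n. trajectory a x (2 * n + k)"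
  obtains l where "1 < l" "s \<longlonglongrightarrow> l"
    | "s \<longlonglongrightarrow> 1" "\<And>n. s n \<le> s 0"
    | "filterlim s at_top sequentially" "\<And>n. s 0 \<le> s n"
  using trajectory_shift_monoseq[OF assms(1-3), of k, folded s_def]
proof
  have gt: "1 < s n" for n using trajectory_gt_1[OF assms(1-3)] by (simp add: s_def)
  {
    assume inc: "incseq s"
    show thesis
    proof (rule incseq_LIMSEQ_or_at_top[OF inc])
      fix l assume "s \<longlonglongrightarrow> l" "\<And>n. s n \<le> l"
      then show thesis using gt[of 0] that(1) by (meson less_le_trans)
    next
      assume "filterlim s at_top sequentially"
      then show thesis using that(3) incseqD[OF inc] by simp
    qed
  next
    assume dec: "decseq s"
    obtain l where l: "s \<longlonglongrightarrow> l"
      using decseq_convergent[OF dec, of 1] gt less_imp_le by metis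
    then have "1 \<le> l" using gt by (intro LIMSEQ_le_const) (auto intro: less_imp_le)
    then consider "1 < l" | "l = 1" by linarith
    then show thesis
    proof cases
      case 1
      then show thesis using l by (rule that(1))
    next
      case 2
      then show thesis using l that(2) decseqD[OF dec] by simp
    qed
  }
qed

lemma trajectory_LIMSEQ_step:
  assumes "1 < a" "a < 10" "1 < l"
    and "(\<lambda>n. trajectory a x (2 * n + k)) \<longlonglongrightarrow> l"
  shows "(\<lambda>n. trajectory a x (2 * n + Suc k)) \<longlonglongrightarrow> L a l"
  using isCont_tendsto_compose[OF L_isCont[OF assms(1-3)] assms(4)]
  by (simp add: trajectory_Suc)

text \<open>Two steps of the map advance \<open>n\<close> by one, and a sequence shifted by one
  index keeps its limit.\<close>

lemma trajectory_even_odd_limits: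
  assumes "1 < a" "a < 10" "1 < l"
    and "(\<lambda>n. trajectory a x (2 * n + k)) \<longlonglongrightarrow> l"
  shows "(\<lambda>n. trajectory a x (2 * n + Suc k)) \<longlonglongrightarrow> L a l" "L a (L a l) = l"
proof -
  show *: "(\<lambda>n. trajectory a x (2 * n + Suc k)) \<longlonglongrightarrow> L a l"
    by (rule trajectory_LIMSEQ_step[OF assms])
  have "(\<lambda>n. trajectory a x (2 * Suc n + k)) \<longlonglongrightarrow> L a (L a l)"
    using trajectory_LIMSEQ_step[OF assms(1,2) L_gt_1[OF assms(1-3)] *] by simp
  moreover have "(\<lambda>n. trajectory a x (2 * Suc n + k)) \<longlonglongrightarrow> l"
    using assms(4) by (rule LIMSEQ_Suc)
  ultimately show "L a (L a l) = l" by (rule LIMSEQ_unique)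
qed

theorem theorem5:
  fixes a \<omega> x :: real
  assumes "1 < a" and "a < 10"
    and "\<omega> > 1" and "L a \<omega> = \<omega>"
    and "x > 1"
  shows
    "(x = \<omega> \<and> (\<forall>n. trajectory a x n = \<omega>))
   \<or> (trajectory a x \<longlonglongrightarrow> \<omega>)
   \<or> (L a (L a x) = x \<and> L a x \<noteq> x \<and> (\<forall>n. trajectory a x (2 * n) = x \<and> trajectory a x (2 * n + 1) = L a x))
   \<or> (\<exists>p q. p \<noteq> q \<and> p > 1 \<and> q > 1 \<and> L a p = q \<and> L a q = p \<and>
        (((\<lambda>n. trajectory a x (2 * n)) \<longlonglongrightarrow> p \<and> (\<lambda>n. trajectory a x (2 * n + 1)) \<longlonglongrightarrow> q) \<or>
         ((\<lambda>n. trajectory a x (2 * n)) \<longlonglongrightarrow> q \<and> (\<lambda>n. trajectory a x (2 * n + 1)) \<longlonglongrightarrow> p)))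
   \<or> (((\<lambda>n. trajectory a x (2 * n)) \<longlonglongrightarrow> 1 \<and> filterlim (\<lambda>n. trajectory a x (2 * n + 1)) at_top sequentially) \<or>
      (filterlim (\<lambda>n. trajectory a x (2 * n)) at_top sequentially \<and> (\<lambda>n. trajectory a x (2 * n + 1)) \<longlonglongrightarrow> 1))"
    (is "_ \<or> ?fix \<or> _ \<or> ?cycle \<or> ?div")
proof -
  note a = assms(1,2) and x = assms(5)
  let ?e = "\<lambda>n. trajectory a x (2 * n)" and ?o = "\<lambda>n. trajectory a x (2 * n + 1)"
  note gt = trajectory_gt_1[OF a x]
  have even_conv: "?fix \<or> ?cycle" if l: "1 < l" "?e \<longlonglongrightarrow> l" for l
  proof -
    have odd: "?o \<longlonglongrightarrow> L a l" and cyc: "L a (L a l) = l"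
      using trajectory_even_odd_limits[OF a l(1), of x 0] l(2) by simp_all
    show ?thesis
    proof (cases "L a l = l")
      case True
      then have "l = \<omega>" using fixed_point_ex1[OF a] assms(3,4) l(1) by blast
      then have ?fix using limseq_even_odd[OF l(2)] odd True by simp
      then show ?thesis ..
    next
      case False
      then have ?cycle using l odd cyc L_gt_1[OF a l(1)] by metis
      then show ?thesis ..
    qed
  qed
  \<comment> \<open>The image of the odd terms is the sequence of even terms without its first
    member, so this case reduces to \<open>even_conv\<close>.\<close>
  have odd_conv: "?fix \<or> ?cycle" if l: "1 < l" "?o \<longlonglongrightarrow> l" for l
  proof -
    have "(\<lambda>n. ?e (Suc n)) \<longlonglongrightarrow> L a l"
      using trajectory_even_odd_limits(1)[OF a l] by simp
    then have "?e \<longlonglongrightarrow> L a l" by (rule LIMSEQ_imp_Suc)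
    then show ?thesis by (rule even_conv[OF L_gt_1[OF a l(1)]])
  qed
  have odd_eq: "?o n = L a (?e n)" for n by (simp add: trajectory_Suc)
  \<comment> \<open>A trajectory that starts at \<omega> or on a two-term cycle also converges to
    it, so three alternatives cover everything.\<close>
  have "?fix \<or> ?cycle \<or> ?div"
  proof (rule trajectory_shift_cases[OF a x, of 0], unfold add_0_right)
    fix l assume "1 < l" "?e \<longlonglongrightarrow> l"
    then show ?thesis using even_conv by blast
  next
    assume e: "?e \<longlonglongrightarrow> 1" and "\<And>n. ?e n \<le> ?e 0"
    \<comment> \<open>\<open>L a\<close> reverses the bound on the even terms. Odd terms that never
      fall below \<open>?o 0 > 1\<close> cannot tend to 1, which leaves \<open>odd_conv\<close> or
      \<open>?div\<close>.\<close>
    then have lower: "?o 0 \<le> ?o n" for n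
      unfolding odd_eq by (intro L_antimono[OF a gt])
    show ?thesis
    proof (rule trajectory_shift_cases[OF a x, of 1])
      assume "?o \<longlonglongrightarrow> 1"
      then have "?o 0 \<le> 1" using lower by (intro LIMSEQ_le_const) auto
      then show ?thesis using gt[of "2 * 0 + 1"] by linarith
    qed (use odd_conv e in blast)+
  next
    assume e: "filterlim ?e at_top sequentially" and "\<And>n. ?e 0 \<le> ?e n"
    \<comment> \<open>Dually, the odd terms are now bounded above and cannot tend to
      \<infinity>.\<close>
    then have upper: "?o n \<le> ?o 0" for n
      unfolding odd_eq by (intro L_antimono[OF a gt])
    show ?thesis
    proof (rule trajectory_shift_cases[OF a x, of 1])
      assume "filterlim ?o at_top sequentially"
      then have "\<forall>\<^sub>F n in sequentially. ?o 0 < ?o n" by (simp only: filterlim_at_top_dense)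
      then have "\<forall>\<^sub>F n in sequentially. False"
        by (rule eventually_mono) (use upper not_le in blast)
      then show ?thesis by simp
    qed (use odd_conv e in blast)+
  qed
  then show ?thesis by blast
qed

end
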